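(* For every integer $n\ge1$, $f_2(5,n)\leq n+10$.
   Context: Graphs are finite and simple with nonempty vertex set. A clique of a graph is a set of pairwise adjacent vertices (sets with at most one vertex are cliques); a clique is maximal if it is maximal with respect to inclusion, and $c(G)$ is the number of maximal cliques of $G$. For integers $t\geq2$ and $n\geq1$, $f_2(t,n)$ is the minimum of $\sum_{i=1}^t c(G_i)$ over all factorizations of the complete graph $K_n$ into $t$ edge-disjoint spanning subgraphs $G_1,\dots,G_t$ (all on the same $n$ vertices, some possibly edgeless, whose edge sets partition the edge set of $K_n$). *)

theory Defs
  imports "HOL-Library.Ramsey" "HOL-Library.Disjoint_Sets"
begin

text \<open>A simple graph is given by a vertex set \<open>V\<close> and an edge set
  \<open>E \<subseteq> [V]\<^bsup>2\<^esup>\<close> of two-element subsets of \<open>V\<close>, so that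
  \<open>[V]\<^bsup>2\<^esup>\<close> is the edge set of the complete graph on \<open>V\<close>.\<close>

definition cliques :: "'a set \<Rightarrow> 'a set set \<Rightarrow> 'a set set" where
  "cliques V E = {C. C \<subseteq> V \<and> clique C E}"

definition maximal_cliques :: "'a set \<Rightarrow> 'a set set \<Rightarrow> 'a set set" where
  "maximal_cliques V E = {C \<in> cliques V E. \<forall>D \<in> cliques V E. C \<subseteq> D \<longrightarrow> D = C}"

definition num_maximal_cliques :: "'a set \<Rightarrow> 'a set set \<Rightarrow> nat" where
  "num_maximal_cliques V E = card (maximal_cliques V E)"

text \<open>Individual factors may be edgeless, so the pieces form an indexed family
  rather than a partition into nonempty blocks.\<close>

definition factorization :: "nat \<Rightarrow> 'a set \<Rightarrow> (nat \<Rightarrow> 'a set set) \<Rightarrow> bool" where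
  "factorization t V G \<longleftrightarrow>
     disjoint_family_on G {..<t} \<and> (\<Union>i<t. G i) = [V]\<^bsup>2\<^esup>"

definition f2 :: "nat \<Rightarrow> nat \<Rightarrow> nat" where
  "f2 t n = (LEAST m. \<exists>G. factorization t {..<n} G \<and>
                          m = (\<Sum>i<t. num_maximal_cliques {..<n} (G i)))"

text \<open>The minimum is attained, since all edges may be put into one factor.\<close>

lemma f2_attained:
  assumes "t \<ge> 1"
  shows "\<exists>G. factorization t {..<n} G \<and>
             f2 t n = (\<Sum>i<t. num_maximal_cliques {..<n} (G i))"
proof -
  let ?G = "\<lambda>i. if i = (0::nat) then [{..<n}]\<^bsup>2\<^esup> else {}"
  have "factorization t {..<n} ?G"
    using assms by (auto simp: factorization_def disjoint_family_on_def split: if_splits)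
  then have "\<exists>m G. factorization t {..<n} G \<and>
               m = (\<Sum>i<t. num_maximal_cliques {..<n} (G i))"
    by blast
  then show ?thesis
    unfolding f2_def by (rule LeastI_ex)
qed

end

theory Submission
  imports Defs
begin

text \<open>
  Let \<open>p\<close> be a point of the affine plane of order 4, which has 16 points and 20 lines in 5 parallel
  classes. Any two points lie on exactly one line, so the parallel classes factorize the complete
  graph on the 16 points into 5 disjoint unions of cliques, and \<open>p\<close> lies in exactly one maximal
  clique of each factor. Substitute for \<open>p\<close> a complete graph on \<open>m\<close> vertices with an arbitrary
  factorization into 5 graphs. In each factor the maximal cliques of the substituted graph extend
  uniquely by the other points of the line through \<open>p\<close>, while the lines avoiding \<open>p\<close> persist.
  So 15 new vertices cost only the 15 lines that avoid \<open>p\<close>: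
  \<open>f2 5 (m + 15) \<le> f2 5 m + 15\<close>, and the excess of \<open>f2 5 n\<close> over \<open>n\<close> does not grow.

  Using only some of the other points (\<open>f2_substitution\<close>), the same substitution with \<open>m = 1\<close>
  yields the initial values \<open>n \<le> 15\<close>: a set of \<open>n\<close> points gives as many maximal cliques as there
  are lines meeting it. The points can be listed so that every initial segment of \<open>n\<close> points meets
  at most \<open>n + 10\<close> lines (\<open>ag24_lines_avoiding_0\<close>).
\<close>

section \<open>Substituting a factorization for a point of a resolvable linear space\<close>

text \<open>This is a single factor of the substitution: a graph \<open>H\<close> on \<open>B\<close> inside a disjoint union of
  complete graphs. A clique stays inside one class, and a class other than the one containing \<open>B\<close> is
  itself a clique. The vertices outside \<open>B\<close> in the class of \<open>B\<close> are adjacent to everything in that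
  class, so a maximal clique there contains all of them and is determined by its trace on \<open>B\<close>.\<close>

lemma maximal_clique_of_union_of_classes:
  fixes cls :: "'a \<Rightarrow> 'c"
  assumes edge: "\<And>u v. u \<in> V \<Longrightarrow> v \<in> V \<Longrightarrow> u \<noteq> v \<Longrightarrow>
      {u, v} \<in> E \<longleftrightarrow> (if u \<in> B \<and> v \<in> B then {u, v} \<in> H else cls u = cls v)"
    and B: "B \<subseteq> V" "B \<noteq> {}" "\<And>u. u \<in> B \<Longrightarrow> cls u = b"
    and C: "C \<in> maximal_cliques V E"
  shows "C \<in> (\<lambda>K. K \<union> {v \<in> V - B. cls v = b}) ` maximal_cliques B H
           \<union> (\<lambda>c. {v \<in> V. cls v = c}) ` (cls ` V - {b})"
proof -
  have CV: "C \<subseteq> V" and Ccl: "clique C E"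
    and Cmax: "\<And>D. D \<subseteq> V \<Longrightarrow> clique D E \<Longrightarrow> C \<subseteq> D \<Longrightarrow> D = C"
    using C by (auto simp: maximal_cliques_def cliques_def)
  have "C \<noteq> {}"
  proof
    assume "C = {}"
    obtain x where "x \<in> B" using B by blast
    then have "{x} = C" using B \<open>C = {}\<close> by (intro Cmax) (auto simp: clique_def)
    then show False using \<open>C = {}\<close> by simp
  qed
  then obtain w where w: "w \<in> C" by blast
  have same: "cls u = cls w" if "u \<in> C" for u
  proof (cases "u = w \<or> (u \<in> B \<and> w \<in> B)")
    case True
    then show ?thesis using B by auto
  next
    case False
    then have "{u, w} \<in> E" using Ccl that w by (auto simp: clique_def)
    moreover have "u \<in> V" "w \<in> V" using that w CV by auto
    ultimately show ?thesis using edge[of u w] False by auto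
  qed
  show ?thesis
  proof (cases "cls w = b")
    case False
    let ?L = "{v \<in> V. cls v = cls w}"
    have "clique ?L E"
      using edge B False by (auto simp: clique_def)
    then have "?L = C" using same CV by (intro Cmax) auto
    moreover have "cls w \<in> cls ` V - {b}" using False w CV by auto
    ultimately show ?thesis by blast
  next
    case True
    let ?L = "{v \<in> V - B. cls v = b}"
    have extend: "clique (K \<union> ?L) E" if "K \<subseteq> B" "clique K H" for K
      unfolding clique_def
    proof (intro ballI impI)
      fix u v assume uv: "u \<in> K \<union> ?L" "v \<in> K \<union> ?L" "u \<noteq> v"
      have "{u, v} \<in> H" if "u \<in> B" "v \<in> B"
        using uv that \<open>clique K H\<close> by (auto simp: clique_def)
      moreover have "u \<in> V" "v \<in> V" using uv \<open>K \<subseteq> B\<close> B(1) by blast+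
      moreover have "cls u = b" "cls v = b" using uv \<open>K \<subseteq> B\<close> B(3) by blast+
      ultimately show "{u, v} \<in> E" using edge[of u v] \<open>u \<noteq> v\<close> by simp
    qed
    have CB: "clique (C \<inter> B) H"
      unfolding clique_def
    proof (intro ballI impI)
      fix u v assume uv: "u \<in> C \<inter> B" "v \<in> C \<inter> B" "u \<noteq> v"
      then have "{u, v} \<in> E" using Ccl by (auto simp: clique_def)
      then show "{u, v} \<in> H" using edge[of u v] uv B(1) by auto
    qed
    have C_sub: "C \<subseteq> (C \<inter> B) \<union> ?L" using same True CV by auto
    have "(C \<inter> B) \<union> ?L = C"
      using extend[of "C \<inter> B"] CB C_sub B(1) by (intro Cmax) auto
    moreover have "D = C \<inter> B" if D: "D \<subseteq> B" "clique D H" "C \<inter> B \<subseteq> D" for D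
    proof -
      have "D \<union> ?L = C"
        using extend[of D] D C_sub by (intro Cmax) (use B(1) in auto)
      then show ?thesis using D by auto
    qed
    then have "C \<inter> B \<in> maximal_cliques B H"
      using CB by (auto simp: maximal_cliques_def cliques_def)
    ultimately show ?thesis by blast
  qed
qed

lemma num_maximal_cliques_union_of_classes_le:
  fixes cls :: "'a \<Rightarrow> 'c"
  assumes edge: "\<And>u v. u \<in> V \<Longrightarrow> v \<in> V \<Longrightarrow> u \<noteq> v \<Longrightarrow>
      {u, v} \<in> E \<longleftrightarrow> (if u \<in> B \<and> v \<in> B then {u, v} \<in> H else cls u = cls v)"
    and B: "B \<subseteq> V" "B \<noteq> {}" "\<And>u. u \<in> B \<Longrightarrow> cls u = b"
    and "finite V"
  shows "num_maximal_cliques V E \<le> num_maximal_cliques B H + card (cls ` V - {b})"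
proof -
  let ?K = "(\<lambda>K. K \<union> {v \<in> V - B. cls v = b}) ` maximal_cliques B H"
  let ?L = "(\<lambda>c. {v \<in> V. cls v = c}) ` (cls ` V - {b})"
  have "finite B" using B(1) \<open>finite V\<close> by (rule finite_subset)
  then have fin: "finite (maximal_cliques B H)"
    by (rule_tac finite_subset[of _ "Pow B"]) (auto simp: maximal_cliques_def cliques_def)
  have "maximal_cliques V E \<subseteq> ?K \<union> ?L"
    using maximal_clique_of_union_of_classes[OF edge B] by blast
  then have "card (maximal_cliques V E) \<le> card (?K \<union> ?L)"
    using fin \<open>finite V\<close> by (intro card_mono) auto
  also have "\<dots> \<le> card ?K + card ?L" by (rule card_Un_le)
  also have "\<dots> \<le> card (maximal_cliques B H) + card (cls ` V - {b})"
    using fin \<open>finite V\<close> by (intro add_mono card_image_le) auto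
  finally show ?thesis by (simp add: num_maximal_cliques_def)
qed

lemma f2_le:
  assumes "factorization t {..<n} G"
  shows "f2 t n \<le> (\<Sum>i<t. num_maximal_cliques {..<n} (G i))"
  unfolding f2_def by (rule Least_le) (use assms in blast)

text \<open>The points \<open>0, \<dots>, k\<close> form a linear space whose lines, possibly of size one, are the level sets
  of the functions \<open>\<pi> i\<close>, one function per parallel class. Point \<open>0\<close> is replaced by a factorization
  of the complete graph on \<open>m\<close> vertices; the lines through \<open>0\<close> are absorbed by its cliques.\<close>

lemma f2_substitution:
  fixes \<pi> :: "nat \<Rightarrow> nat \<Rightarrow> 'c"
  assumes line: "\<And>a b. a < b \<Longrightarrow> b \<le> k \<Longrightarrow> \<exists>!i. i < t \<and> \<pi> i a = \<pi> i b"
    and "t \<ge> 1" and "m \<ge> 1"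
  shows "f2 t (m + k) \<le> f2 t m + (\<Sum>i<t. card (\<pi> i ` {1..k} - {\<pi> i 0}))"
proof -
  obtain G where G: "factorization t {..<m} G"
    and f2_m: "f2 t m = (\<Sum>i<t. num_maximal_cliques {..<m} (G i))"
    using f2_attained[OF \<open>t \<ge> 1\<close>] by blast
  \<comment> \<open>The vertices below \<open>m\<close> lie over the point \<open>0\<close>, and \<open>m, \<dots>, m + k - 1\<close> over \<open>1, \<dots>, k\<close>.\<close>
  define \<phi> :: "nat \<Rightarrow> nat" where "\<phi> v = v + 1 - m" for v
  let ?V = "{..<m + k}"
  define R where "R i u v \<longleftrightarrow>
      (if u < m \<and> v < m then {u, v} \<in> G i else \<pi> i (\<phi> u) = \<pi> i (\<phi> v))" for i u v
  define E where "E i = {{u, v} |u v. u \<in> ?V \<and> v \<in> ?V \<and> u \<noteq> v \<and> R i u v}" for i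
  have R_sym: "R i v u \<longleftrightarrow> R i u v" for i u v
    by (simp add: R_def insert_commute[of v u] eq_commute[of "\<pi> i (\<phi> v)"] conj_commute)
  have edge_R: "{u, v} \<in> E i \<longleftrightarrow> R i u v" if "u \<in> ?V" "v \<in> ?V" "u \<noteq> v" for u v i
    unfolding E_def using that by (auto simp: doubleton_eq_iff R_sym[of i u v])
  note edge = edge_R[unfolded R_def]
  have unique_factor: "\<exists>!i. i < t \<and> {u, v} \<in> E i" if uv: "u < v" "v < m + k" for u v
  proof (cases "v < m")
    case True
    have "{u, v} \<in> [{..<m}]\<^bsup>2\<^esup>" using True uv by (auto simp: nsets_def)
    also have "[{..<m}]\<^bsup>2\<^esup> = (\<Union>i<t. G i)" using G by (simp add: factorization_def)
    finally obtain i where i: "i < t" "{u, v} \<in> G i" by blast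
    have "j = i" if "j < t" "{u, v} \<in> G j" for j
      using G i that by (auto simp: factorization_def disjoint_family_on_def)
    then show ?thesis using i edge[of u v] True uv by auto
  next
    case False
    have "\<phi> u < \<phi> v" "\<phi> v \<le> k" using False uv by (auto simp: \<phi>_def)
    then show ?thesis using line[of "\<phi> u" "\<phi> v"] edge[of u v] False uv by auto
  qed
  have pair: "\<exists>u v. e = {u, v} \<and> u < v \<and> v < m + k" if "e \<in> [?V]\<^bsup>2\<^esup>" for e
  proof -
    obtain u v where uv: "e = {u, v}" "u \<in> ?V" "v \<in> ?V" "u \<noteq> v"
      using \<open>e \<in> [?V]\<^bsup>2\<^esup>\<close> by (auto simp: nsets_2_eq)
    show ?thesis
    proof (cases "u < v")
      case False
      then have "e = {v, u}" "v < u" using uv by auto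
      then show ?thesis using uv by blast
    qed (use uv in blast)
  qed
  have E_sub: "E i \<subseteq> [?V]\<^bsup>2\<^esup>" for i
    unfolding E_def nsets_def by auto
  have "factorization t ?V E"
    unfolding factorization_def disjoint_family_on_def
  proof (intro conjI ballI impI)
    fix i j assume ij: "i \<in> {..<t}" "j \<in> {..<t}" "i \<noteq> j"
    show "E i \<inter> E j = {}"
    proof (rule equals0I)
      fix e assume e: "e \<in> E i \<inter> E j"
      then obtain u v where "e = {u, v}" "u < v" "v < m + k" using E_sub pair by blast
      then show False using unique_factor[of u v] e ij by auto
    qed
  next
    show "(\<Union>i<t. E i) = [?V]\<^bsup>2\<^esup>"
    proof
      show "[?V]\<^bsup>2\<^esup> \<subseteq> (\<Union>i<t. E i)"
        using pair unique_factor by fastforce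
    qed (use E_sub in blast)
  qed
  then have "f2 t (m + k) \<le> (\<Sum>i<t. num_maximal_cliques ?V (E i))" by (rule f2_le)
  also have "\<dots> \<le> (\<Sum>i<t. num_maximal_cliques {..<m} (G i) + card (\<pi> i ` {1..k} - {\<pi> i 0}))"
  proof (rule sum_mono)
    fix i
    have "num_maximal_cliques ?V (E i)
        \<le> num_maximal_cliques {..<m} (G i) + card ((\<lambda>v. \<pi> i (\<phi> v)) ` ?V - {\<pi> i 0})"
      by (rule num_maximal_cliques_union_of_classes_le) (use edge \<open>m \<ge> 1\<close> in \<open>auto simp: \<phi>_def lessThan_empty_iff\<close>)
    also have "card ((\<lambda>v. \<pi> i (\<phi> v)) ` ?V - {\<pi> i 0}) \<le> card (\<pi> i ` {1..k} - {\<pi> i 0})"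
    proof (rule card_mono)
      have "\<phi> v = 0 \<or> \<phi> v \<in> {1..k}" if "v < m + k" for v
        using that by (auto simp: \<phi>_def)
      then show "(\<lambda>v. \<pi> i (\<phi> v)) ` ?V - {\<pi> i 0} \<subseteq> \<pi> i ` {1..k} - {\<pi> i 0}" by fastforce
    qed simp
    finally show "num_maximal_cliques ?V (E i)
        \<le> num_maximal_cliques {..<m} (G i) + card (\<pi> i ` {1..k} - {\<pi> i 0})"
      by simp
  qed
  also have "\<dots> = f2 t m + (\<Sum>i<t. card (\<pi> i ` {1..k} - {\<pi> i 0}))"
    by (simp add: f2_m sum.distrib)
  finally show ?thesis .
qed

section \<open>The affine plane of order 4\<close>

text \<open>The elements \<open>0, 1, \<omega>, \<omega> + 1\<close> of the field with 4 elements are coded by \<open>0, 1, 2, 3\<close>, where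
  \<open>\<omega>\<^sup>2 = \<omega> + 1\<close>. Addition is also subtraction.\<close>

definition gf4_add :: "nat \<Rightarrow> nat \<Rightarrow> nat" where
  "gf4_add a b = [[0,1,2,3], [1,0,3,2], [2,3,0,1], [3,2,1,0]] ! a ! b"

definition gf4_mult :: "nat \<Rightarrow> nat \<Rightarrow> nat" where
  "gf4_mult a b = [[0,0,0,0], [0,1,2,3], [0,2,3,1], [0,3,1,2]] ! a ! b"

text \<open>The first six points form a hyperoval (no three of them are collinear), which keeps the number
  of lines met by a short initial segment small: every further point lies on three lines that join
  two of the six, and so it meets at most two new lines.\<close>

definition ag24_points :: "(nat \<times> nat) list" where
  "ag24_points = [(0,0), (0,1), (1,0), (1,2), (2,1), (2,2), (0,2), (1,1),
                  (0,3), (1,3), (2,0), (2,3), (3,0), (3,1), (3,2), (3,3)]"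

text \<open>The lines of parallel class \<open>i < 4\<close> are \<open>y = i * x + c\<close> and those of class \<open>4\<close> are \<open>x = c\<close>.
  The value is the parameter \<open>c\<close> of the line through point number \<open>j\<close>.\<close>

definition ag24_line :: "nat \<Rightarrow> nat \<Rightarrow> nat" where
  "ag24_line i j =
     (case ag24_points ! j of (x, y) \<Rightarrow> if i = 4 then x else gf4_add y (gf4_mult i x))"

lemma ag24_unique_line:
  assumes "a < b" "b \<le> 15"
  shows "\<exists>!i. i < 5 \<and> ag24_line i a = ag24_line i b"
proof -
  let ?common = "\<lambda>a b. filter (\<lambda>i. ag24_line i a = ag24_line i b) [0..<5]"
  have "\<forall>b \<in> set [0..<16]. \<forall>a \<in> set [0..<b]. length (?common a b) = 1"
    by code_simp
  then have "length (?common a b) = 1" using assms by simp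
  then obtain i where "?common a b = [i]" by (auto simp: length_Suc_conv)
  then have "set (?common a b) = {i}" by simp
  then have "j < 5 \<and> ag24_line j a = ag24_line j b \<longleftrightarrow> j = i" for j
    by (auto simp: set_eq_iff)
  then show ?thesis by simp
qed

text \<open>Together with the 5 lines through point \<open>0\<close>, this says that the first \<open>n = k + 1\<close> points meet
  at most \<open>n + 10\<close> lines.\<close>

lemma ag24_lines_avoiding_0:
  assumes "k \<le> 14"
  shows "(\<Sum>i<5. card (ag24_line i ` {1..k} - {ag24_line i 0})) \<le> k + 6"
proof -
  have "\<forall>k \<in> {..14}. (\<Sum>i<5. card (ag24_line i ` {1..k} - {ag24_line i 0})) \<le> k + 6"
    by code_simp
  then show ?thesis using assms by simp
qed

lemma ag24_all_lines_avoiding_0: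
  "(\<Sum>i<5. card (ag24_line i ` {1..15} - {ag24_line i 0})) = 15"
  by code_simp

section \<open>The bound for five factors\<close>

lemma f2_one_le: "f2 t 1 \<le> t"
proof -
  have "factorization t {..<1::nat} (\<lambda>i. {})"
    by (auto simp: factorization_def disjoint_family_on_def nsets_2_eq)
  moreover have "maximal_cliques {..<1::nat} {} = {{0}}"
    by (auto simp: maximal_cliques_def cliques_def clique_def)
  ultimately show ?thesis using f2_le[of t 1 "\<lambda>i. {}"] by (simp add: num_maximal_cliques_def)
qed

theorem theorem26:
  fixes n :: nat
  assumes "n \<ge> 1"
  shows "f2 5 n \<le> n + 10"
  using assms
proof (induction n rule: less_induct)
  case (less n)
  show ?case
  proof (cases "n \<le> 15")
    case True
    define k where "k = n - 1"
    have "n = 1 + k" "k \<le> 14" using True less.prems by (auto simp: k_def)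
    have "f2 5 (1 + k) \<le> f2 5 1 + (\<Sum>i<5. card (ag24_line i ` {1..k} - {ag24_line i 0}))"
      by (rule f2_substitution) (use ag24_unique_line \<open>k \<le> 14\<close> in auto)
    then show ?thesis
      using f2_one_le[of 5] ag24_lines_avoiding_0[OF \<open>k \<le> 14\<close>]
      unfolding \<open>n = 1 + k\<close> by linarith
  next
    case False
    define m where "m = n - 15"
    have "n = m + 15" "m \<ge> 1" using False by (auto simp: m_def)
    have "f2 5 (m + 15) \<le> f2 5 m + (\<Sum>i<5. card (ag24_line i ` {1..15} - {ag24_line i 0}))"
      by (rule f2_substitution) (use ag24_unique_line \<open>m \<ge> 1\<close> in auto)
    then show ?thesis
      using less.IH[of m] ag24_all_lines_avoiding_0 \<open>m \<ge> 1\<close>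
      unfolding \<open>n = m + 15\<close> by linarith
  qed
qed

end
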